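(* In the setting of the context, assume in addition that $p$ is even, i.e. $p(-x)=p(x)$ for all $x$. Then for every integer $m\ge 0$ there is a constant $C_m$ (depending on $m$ and $p$) such that for all $N\ge1$, \[ \mathbb{E}\Big[\big|M_m(A,N)-\mathbb{E}[M_m(A,N)]\big|^4\Big]\;\le\;\frac{C_m}{N^2}. \]
   Context: Let $p$ be a probability density on $\mathbb{R}$ with mean $0$, variance $1$ and finite moments of all orders. For $N\ge 1$, let $b_1,\dots,b_{N-1}$ be independent random variables with density $p$, set $b_0=0$, and let $A=A_N$ be the $N\times N$ real symmetric Toeplitz matrix with entries $a_{ij}=b_{|i-j|}$ ($1\le i,j\le N$). Let $\lambda_1(A),\dots,\lambda_N(A)$ be its eigenvalues. For an integer $k\ge 0$ define $M_k(A,N)=N^{-(k/2+1)}\sum_{i=1}^N\lambda_i(A)^k = N^{-(k/2+1)}\,\mathrm{Trace}(A^k)$, and $M_k(N)=\mathbb{E}[M_k(A,N)]$, the expectation over the random entries. *)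

theory Defs
  imports "HOL-Probability.Probability" "Jordan_Normal_Form.Matrix"
begin

definition toeplitz_mat :: "nat \<Rightarrow> (nat \<Rightarrow> real) \<Rightarrow> real mat" where
  "toeplitz_mat N b = mat N N (\<lambda>(i, j). if i = j then 0 else b (nat \<bar>int i - int j\<bar>))"

definition mat_trace :: "real mat \<Rightarrow> real" where
  "mat_trace A = (\<Sum>i<dim_row A. A $$ (i, i))"

definition moment_stat :: "nat \<Rightarrow> nat \<Rightarrow> (nat \<Rightarrow> real) \<Rightarrow> real" where
  "moment_stat N k b = mat_trace (toeplitz_mat N b ^\<^sub>m k) / real N powr (real k / 2 + 1)"

end

theory Submission
  imports Defs
begin

text \<open>
  Expanding the trace over closed walks $x_0, \dots, x_m = x_0$ in $\{0, \dots, N-1\}$, the fourth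
  central moment of the trace becomes a sum over quadruples of closed walks of the expectation of a
  product of four centred monomials in the $b_c$, where $c$ ranges over the gaps $|x_k - x_{k+1}|$.
  Each such expectation is bounded in terms of $m$ and $p$, and it vanishes by independence if some
  gap occurs exactly once in the quadruple or if one walk shares no gap with the other three.
  So it suffices that only $O(N^{2m+2})$ quadruples are left. A quadruple is fixed, up to a choice
  among finitely many patterns, by its four starting points and its distinct gaps, of which there
  are at most $2m$. Two of these parameters are superfluous: a gap occurring exactly once in a walk
  can be recovered because the steps of a closed walk sum to zero, and every gap occurring more
  than twice lowers the number of distinct gaps.
\<close>

section \<open>Counting linked quadruples of closed walks\<close>

text \<open>
  Here \<open>n w c\<close> counts the occurrences of the gap \<open>c\<close> in the walk \<open>w\<close>. The gaps in \<open>T\<close> are those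
  that are recovered from the others: the last conclusion says that \<open>V\<close> is the closure of \<open>V - T\<close>
  under adding a gap that occurs once in a walk all of whose other gaps are already known.
\<close>

lemma dropped_values:
  fixes n :: "nat \<Rightarrow> 'c \<Rightarrow> nat"
  assumes fin: "finite V"
    and tot: "\<And>w. w < 4 \<Longrightarrow> (\<Sum>c\<in>V. n w c) = m"
    and two: "\<And>c. c \<in> V \<Longrightarrow> (\<Sum>w<4. n w c) \<ge> 2"
    and share: "\<And>w. w < 4 \<Longrightarrow> \<exists>c\<in>V. \<exists>w'<4. w' \<noteq> w \<and> n w c > 0 \<and> n w' c > 0"
  obtains T where "T \<subseteq> V" "card (V - T) + 2 \<le> 2 * m"
    "\<And>K. V - T \<subseteq> K \<Longrightarrow>
       (\<And>w u. w < 4 \<Longrightarrow> u \<in> V \<Longrightarrow> n w u = 1 \<Longrightarrow>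
         (\<And>c. c \<in> V \<Longrightarrow> n w c > 0 \<Longrightarrow> c \<noteq> u \<Longrightarrow> c \<in> K) \<Longrightarrow> u \<in> K) \<Longrightarrow> V \<subseteq> K"
proof -
  define t where "t c = (\<Sum>w<4. n w c)" for c
  have t_expand: "t c = n 0 c + n 1 c + n 2 c + n 3 c" for c
    by (simp add: t_def numeral_eq_Suc)
  have lt4: "w = 0 \<or> w = 1 \<or> w = 2 \<or> w = 3" if "w < 4" for w :: nat
    using that by auto
  have t2: "n w c + n w' c \<le> t c" if "w < 4" "w' < 4" "w \<noteq> w'" for w w' c
    using lt4[OF that(1)] lt4[OF that(2)] that(3) unfolding t_expand by auto
  have t3: "n w c + n w' c + n w'' c \<le> t c"
    if "w < 4" "w' < 4" "w'' < 4" "w \<noteq> w'" "w \<noteq> w''" "w' \<noteq> w''" for w w' w'' c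
    using lt4[OF that(1)] lt4[OF that(2)] lt4[OF that(3)] that(4-6) unfolding t_expand by auto
  have "(\<Sum>c\<in>V. t c) = (\<Sum>w<4. \<Sum>c\<in>V. n w c)"
    unfolding t_def by (rule sum.swap)
  also have "\<dots> = 4 * m"
    using tot by simp
  finally have sum_t: "(\<Sum>c\<in>V. t c) = 4 * m" .
  have t_ge: "2 \<le> t c" if "c \<in> V" for c
    using two[OF that] by (simp add: t_def)
  \<comment> \<open>The gap \<open>c0\<close> is shared by walk 0 and \<open>w1\<close>. The walk
    \<open>w'\<close> is chosen outside this pair, and \<open>c1\<close> is a gap that it shares
    with some \<open>w2\<close>, so the sharing of \<open>c1\<close> always involves a third
    walk.\<close>
  obtain c0 w1 where c0: "c0 \<in> V" "w1 < 4" "w1 \<noteq> 0" "n 0 c0 > 0" "n w1 c0 > 0"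
    using share[of 0] by auto
  obtain w' where w': "w' < 4" "w' \<noteq> 0" "w' \<noteq> w1"
  proof (cases "w1 = 1")
    case True
    then show ?thesis using that[of 2] by simp
  next
    case False
    then show ?thesis using that[of 1] by simp
  qed
  obtain c1 w2 where c1: "c1 \<in> V" "w2 < 4" "w2 \<noteq> w'" "n w' c1 > 0" "n w2 c1 > 0"
    using share[OF w'(1)] by auto
  show ?thesis
  proof (cases "\<exists>u\<in>V. \<exists>w<4. n w u = 1")
    case single: True
    show ?thesis
    proof (cases "\<exists>c\<in>V. t c \<noteq> 2")
      case True
      obtain u w where u: "u \<in> V" "w < 4" "n w u = 1"
        using single by auto
      \<comment> \<open>The totals are at least 2, not all equal to 2, and add up to
        \<open>4 * m\<close>. Hence there are fewer than \<open>2 * m\<close> gaps, and dropping the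
        single gap \<open>u\<close> is enough.\<close>
      have "(\<Sum>c\<in>V. 2) < (\<Sum>c\<in>V. t c)"
        by (rule sum_strict_mono_ex1) (use fin t_ge True in \<open>force+\<close>)
      then have "card V < 2 * m"
        using sum_t by simp
      moreover have "card (V - {u}) = card V - 1" "card V > 0"
        using u(1) fin by (auto simp: card_gt_0_iff)
      ultimately have "card (V - {u}) + 2 \<le> 2 * m"
        by simp
      then show ?thesis
        by (intro that[of "{u}"]) (use u in \<open>blast+\<close>)
    next
      case False
      then have t_eq: "t c = 2" if "c \<in> V" for c
        using that by auto
      have "n 0 c0 = 1" "n w' c0 = 0"
        using t3[of 0 w1 w' c0] t2[of 0 w1 c0] c0 w' t_eq[OF c0(1)] by auto
      moreover have "n w' c1 = 1"
        using t2[of w' w2 c1] c1 w' t_eq[OF c1(1)] by auto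
      ultimately have n: "n 0 c0 = 1" "n w' c0 = 0" "n w' c1 = 1" "c0 \<noteq> c1"
        by auto
      have "2 * card V = 4 * m"
        using sum_t t_eq by simp
      moreover have "card (V - {c0, c1}) = card V - 2" "card V \<ge> 2"
        using c0(1) c1(1) n(4) fin card_mono[of V "{c0, c1}"] by (auto simp: card_Diff_subset)
      ultimately have card: "card (V - {c0, c1}) + 2 \<le> 2 * m"
        by simp
      show ?thesis
      proof (rule that[OF _ card])
        show "{c0, c1} \<subseteq> V" using c0 c1 by auto
      next
        fix K
        assume K: "V - {c0, c1} \<subseteq> K"
          and close: "\<And>w u. w < 4 \<Longrightarrow> u \<in> V \<Longrightarrow> n w u = 1 \<Longrightarrow>
            (\<And>c. c \<in> V \<Longrightarrow> n w c > 0 \<Longrightarrow> c \<noteq> u \<Longrightarrow> c \<in> K) \<Longrightarrow> u \<in> K"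
        \<comment> \<open>The order matters: \<open>c1\<close> is recovered first, from
          \<open>w'\<close>, where the other unknown gap \<open>c0\<close> does not occur; then
          \<open>c0\<close> is the only unknown gap of walk 0.\<close>
        have "c1 \<in> K"
        proof (rule close[OF w'(1) c1(1) n(3)])
          fix c assume "c \<in> V" "n w' c > 0" "c \<noteq> c1"
          then show "c \<in> K" using K n(2) by (cases "c = c0") auto
        qed
        moreover from this have "c0 \<in> K"
          by (intro close[of 0 c0]) (use K c0 n in auto)
        ultimately show "V \<subseteq> K" using K by auto
      qed
    qed
  next
    case False
    then have nge: "n w c \<ge> 2" if "n w c > 0" "w < 4" "c \<in> V" for w c
      using that by (metis One_nat_def Suc_leI le_neq_implies_less numeral_2_eq_2)
    have n4: "n 0 c0 \<ge> 2" "n w1 c0 \<ge> 2" "n w' c1 \<ge> 2" "n w2 c1 \<ge> 2"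
      using nge c0 c1 w' by auto
    \<comment> \<open>Every gap of a walk is now repeated in it. If \<open>c0 = c1\<close>, three
      walks use this gap at least twice each, for a total of at least 6; otherwise \<open>c0\<close>
      and \<open>c1\<close> both have total at least 4. Either way the totals exceed 2 per gap by at
      least 4 altogether, and no gap has to be dropped.\<close>
    have "2 * card V + 4 \<le> 4 * m"
    proof (cases "c0 = c1")
      case True
      have "6 \<le> t c0"
        using t3[of 0 w1 w' c0] c0 w' n4 True by simp
      moreover have "(\<Sum>c\<in>V - {c0}. 2) \<le> (\<Sum>c\<in>V - {c0}. t c)"
        by (rule sum_mono) (use t_ge in auto)
      ultimately have "6 + 2 * card (V - {c0}) \<le> 4 * m"
        using sum_t sum.remove[OF fin c0(1), of t] by simp
      then show ?thesis using c0(1) fin by simp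
    next
      case False
      have "4 \<le> t c0" "4 \<le> t c1"
        using t2[of 0 w1 c0] t2[of w' w2 c1] c0 c1 w' n4 by auto
      moreover have "(\<Sum>c\<in>V - {c0} - {c1}. 2) \<le> (\<Sum>c\<in>V - {c0} - {c1}. t c)"
        by (rule sum_mono) (use t_ge in auto)
      moreover have "(\<Sum>c\<in>V. t c) = t c0 + (t c1 + (\<Sum>c\<in>V - {c0} - {c1}. t c))"
        using fin c0(1) c1(1) False by (subst sum.remove[OF fin c0(1)], subst sum.remove[of _ c1]) auto
      moreover have "card V \<le> card (V - {c0} - {c1}) + 2"
        using c0(1) c1(1) False fin by simp
      ultimately show ?thesis using sum_t by simp
    qed
    then have "card (V - {}) + 2 \<le> 2 * m" by simp
    then show ?thesis by (intro that[of "{}"]) auto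
  qed
qed

section \<open>Closed walks, their gaps, and the quadruples that have to be counted\<close>

definition step :: "(nat \<Rightarrow> nat) \<Rightarrow> nat \<Rightarrow> int" where
  "step x k = int (x k) - int (x (Suc k))"

definition gap :: "(nat \<Rightarrow> nat) \<Rightarrow> nat \<Rightarrow> nat" where
  "gap x k = nat \<bar>step x k\<bar>"

definition occ :: "nat \<Rightarrow> (nat \<Rightarrow> nat) \<Rightarrow> nat \<Rightarrow> nat" where
  "occ m x c = card {k\<in>{..<m}. gap x k = c}"

text \<open>Stationary steps are excluded because they meet the zero diagonal of the matrix; all
  gaps then lie in \<open>{1..<N}\<close>. Walks are extensional functions, so that there are
  finitely many and equality can be checked on \<open>{..m}\<close>.\<close>

definition closed_walks :: "nat \<Rightarrow> nat \<Rightarrow> (nat \<Rightarrow> nat) set" where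
  "closed_walks N m = {x \<in> {..m} \<rightarrow>\<^sub>E {..<N}. x m = x 0 \<and> (\<forall>k<m. x k \<noteq> x (Suc k))}"

text \<open>The quadruples that escape both reasons for a zero expectation: a gap occurring exactly
  once in all, and a walk sharing no gap with the others.\<close>

definition linked_walks :: "nat \<Rightarrow> nat \<Rightarrow> (nat \<Rightarrow> nat \<Rightarrow> nat) set" where
  "linked_walks N m = {X \<in> {..<4} \<rightarrow>\<^sub>E closed_walks N m.
     (\<forall>c\<in>{1..<N}. (\<Sum>w<4. occ m (X w) c) \<noteq> 1) \<and>
     (\<forall>w<4. \<exists>c\<in>{1..<N}. \<exists>w'<4. w' \<noteq> w \<and> occ m (X w) c > 0 \<and> occ m (X w') c > 0)}"

lemma finite_closed_walks: "finite (closed_walks N m)"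
  unfolding closed_walks_def by (rule finite_subset[of _ "{..m} \<rightarrow>\<^sub>E {..<N}"]) (auto intro: finite_PiE)

lemma closed_walks_less: "x \<in> closed_walks N m \<Longrightarrow> k \<le> m \<Longrightarrow> x k < N"
  unfolding closed_walks_def by auto

lemma gap_in: "x \<in> closed_walks N m \<Longrightarrow> k < m \<Longrightarrow> gap x k \<in> {1..<N}"
  using closed_walks_less[of x N m k] closed_walks_less[of x N m "Suc k"]
  by (auto simp: gap_def step_def closed_walks_def)

lemma occ_pos_iff: "occ m x c > 0 \<longleftrightarrow> (\<exists>k<m. gap x k = c)"
  by (auto simp: occ_def card_gt_0_iff)

lemma sum_occ:
  assumes "finite V" "\<And>k. k < m \<Longrightarrow> gap x k \<in> V"
  shows "(\<Sum>c\<in>V. occ m x c) = m"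
proof -
  have "(\<Sum>c\<in>V. occ m x c) = card {..<m}"
    unfolding occ_def
    by (subst sum_fun_comp[symmetric, where f = "\<lambda>_. 1::nat", simplified]) (use assms in auto)
  then show ?thesis by simp
qed

lemma sum_step: "(\<Sum>k<m. step x k) = int (x 0) - int (x m)"
  unfolding step_def by (induction m) auto

text \<open>The closure property of \<open>dropped_values\<close>, with the known gaps given by
  positions \<open>(w, k)\<close> instead of values. There are boundedly many sets of positions,
  whatever \<open>N\<close> is, so such a set can be part of an encoding at constant cost.\<close>

definition determining :: "nat \<Rightarrow> (nat \<Rightarrow> nat \<Rightarrow> nat) \<Rightarrow> (nat \<times> nat) set \<Rightarrow> bool" where
  "determining m X R \<longleftrightarrow>
    (\<forall>K. (\<forall>(w, k)\<in>R. gap (X w) k \<in> K) \<longrightarrow>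
       (\<forall>w<4. \<forall>k<m. occ m (X w) (gap (X w) k) = 1 \<longrightarrow>
          (\<forall>l<m. gap (X w) l \<noteq> gap (X w) k \<longrightarrow> gap (X w) l \<in> K) \<longrightarrow> gap (X w) k \<in> K) \<longrightarrow>
       (\<forall>w<4. \<forall>k<m. gap (X w) k \<in> K))"

lemma linked_walks_determined:
  assumes X: "X \<in> linked_walks N m"
  shows "\<exists>R \<subseteq> {..<4} \<times> {..<m}. card R + 2 \<le> 2 * m \<and> determining m X R"
proof -
  define P :: "(nat \<times> nat) set" where "P = {..<4} \<times> {..<m}"
  define g where "g = (\<lambda>(w, k). gap (X w) k)"
  define V where "V = g ` P"
  have fin: "finite V" by (simp add: V_def P_def)
  have cw: "X w \<in> closed_walks N m" if "w < 4" for w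
    using X that by (auto simp: linked_walks_def)
  have VI: "gap (X w) k \<in> V" if "w < 4" "k < m" for w k
    unfolding V_def P_def g_def using that by force
  have V_sub: "V \<subseteq> {1..<N}"
    using gap_in[OF cw] by (force simp: V_def P_def g_def)
  have VD: "\<exists>w<4. occ m (X w) c > 0" if "c \<in> V" for c
    using that by (force simp: V_def P_def g_def occ_pos_iff)
  have VI': "c \<in> V" if "w < 4" "occ m (X w) c > 0" for w c
    using that VI by (auto simp: occ_pos_iff)
  have tot: "(\<Sum>c\<in>V. occ m (X w) c) = m" if "w < 4" for w
    using fin VI that by (intro sum_occ) auto
  have two: "(\<Sum>w<4. occ m (X w) c) \<ge> 2" if c: "c \<in> V" for c
  proof -
    obtain w where w: "w < 4" "occ m (X w) c > 0" using VD[OF c] by auto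
    have "(\<Sum>w<4. occ m (X w) c) > 0"
      using w by (intro sum_pos2[of _ w]) auto
    moreover have "(\<Sum>w<4. occ m (X w) c) \<noteq> 1"
      using X c V_sub by (auto simp: linked_walks_def)
    ultimately show ?thesis by linarith
  qed
  have share: "\<exists>c\<in>V. \<exists>w'<4. w' \<noteq> w \<and> occ m (X w) c > 0 \<and> occ m (X w') c > 0" if w: "w < 4" for w
  proof -
    have "\<exists>c\<in>{1..<N}. \<exists>w'<4. w' \<noteq> w \<and> occ m (X w) c > 0 \<and> occ m (X w') c > 0"
      using X w unfolding linked_walks_def by blast
    then show ?thesis using VI'[OF w] by blast
  qed
  obtain T where T: "T \<subseteq> V" "card (V - T) + 2 \<le> 2 * m"
    "\<And>K. V - T \<subseteq> K \<Longrightarrow>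
       (\<And>w u. w < 4 \<Longrightarrow> u \<in> V \<Longrightarrow> occ m (X w) u = 1 \<Longrightarrow>
         (\<And>c. c \<in> V \<Longrightarrow> occ m (X w) c > 0 \<Longrightarrow> c \<noteq> u \<Longrightarrow> c \<in> K) \<Longrightarrow> u \<in> K) \<Longrightarrow> V \<subseteq> K"
    by (rule dropped_values[OF fin tot two share]) blast+
  \<comment> \<open>One position is chosen as representative of each gap in
    \<open>V - T\<close>.\<close>
  define R where "R = inv_into P g ` (V - T)"
  have R_sub: "R \<subseteq> P"
  proof
    fix r assume "r \<in> R"
    then obtain c where "c \<in> g ` P" "r = inv_into P g c" unfolding R_def V_def by blast
    then show "r \<in> P" by (simp only: inv_into_into)
  qed
  have "card R \<le> card (V - T)"
    unfolding R_def by (rule card_image_le) (use fin in auto)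
  then have cardR: "card R + 2 \<le> 2 * m" using T(2) by simp
  have gR: "g ` R = V - T"
    unfolding R_def image_image by (force simp: V_def f_inv_into_f)
  show ?thesis
    unfolding determining_def
  proof (intro exI[of _ R] conjI allI impI cardR)
    show "R \<subseteq> {..<4} \<times> {..<m}" using R_sub by (simp add: P_def)
  next
    fix K and w k :: nat
    assume R: "\<forall>(w, k)\<in>R. gap (X w) k \<in> K" and close: "\<forall>w<4. \<forall>k<m. occ m (X w) (gap (X w) k) = 1 \<longrightarrow>
          (\<forall>l<m. gap (X w) l \<noteq> gap (X w) k \<longrightarrow> gap (X w) l \<in> K) \<longrightarrow> gap (X w) k \<in> K"
      and wk: "w < 4" "k < m"
    have "V \<subseteq> K"
    proof (rule T(3))
      show "V - T \<subseteq> K" using R unfolding gR[symmetric] by (auto simp: g_def)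
    next
      fix w u
      assume w: "w < 4" "u \<in> V" "occ m (X w) u = 1"
        and oth: "\<And>c. c \<in> V \<Longrightarrow> occ m (X w) c > 0 \<Longrightarrow> c \<noteq> u \<Longrightarrow> c \<in> K"
      then obtain k where k: "k < m" "gap (X w) k = u"
        using occ_pos_iff[of m "X w" u] by auto
      have "\<forall>l<m. gap (X w) l \<noteq> gap (X w) k \<longrightarrow> gap (X w) l \<in> K"
        using oth VI w(1) k by (auto simp: occ_pos_iff)
      then show "u \<in> K" using close w k by auto
    qed
    then show "gap (X w) k \<in> K" using VI[OF wk] by auto
  qed
qed

lemma step_in: "x \<in> closed_walks N m \<Longrightarrow> k < m \<Longrightarrow> step x k \<in> {- int N..int N}"
  using closed_walks_less[of x N m k] closed_walks_less[of x N m "Suc k"]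
  by (auto simp: step_def)

lemma closed_walks_eqI:
  assumes "x \<in> closed_walks N m" "y \<in> closed_walks N m" "x 0 = y 0"
    and "\<And>k. k < m \<Longrightarrow> step x k = step y k"
  shows "x = y"
proof (rule PiE_ext[of _ "{..m}" "\<lambda>_. {..<N}"])
  fix k assume "k \<in> {..m}"
  then have "k \<le> m" by simp
  then show "x k = y k"
  proof (induction k)
    case (Suc k)
    then show ?case using assms(4)[of k] by (auto simp: step_def)
  qed (use assms in auto)
qed (use assms in \<open>auto simp: closed_walks_def\<close>)

text \<open>A quadruple is encoded injectively by its four starting points, the pattern of equal and
  opposite steps, a determining set of positions, and the steps at these positions. Only the
  starting points, 4 in number, and at most \<open>2 * m - 2\<close> steps have a range that grows
  with \<open>N\<close>.\<close>

lemma card_linked_walks: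
  "\<exists>C. \<forall>N\<ge>1. real (card (linked_walks N m)) \<le> C * real N ^ (2 * m + 2)"
proof -
  define P :: "(nat \<times> nat) set" where "P = {..<4} \<times> {..<m}"
  define sets where "sets = {R \<in> Pow P. card R + 2 \<le> 2 * m}"
  have finP: "finite P" and fins: "finite sets" by (simp_all add: P_def sets_def)
  \<comment> \<open>The factors count the possible \<open>eq_rel\<close>, the possible
    \<open>neg_rel\<close> and the sets of positions; the power of 3 comes from
    \<open>2 * N + 1 \<le> 3 * N\<close>.\<close>
  define C where "C = 2 ^ card (P \<times> P) * (2 ^ card (P \<times> P) * (card sets * 3 ^ (2 * m)))"
  have "real (card (linked_walks N m)) \<le> real C * real N ^ (2 * m + 2)" if N: "N \<ge> 1" for N
  proof -
    define d where "d X = (\<lambda>(w, k). step (X w) k)" for X :: "nat \<Rightarrow> nat \<Rightarrow> nat"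
    have abs_d: "gap (X w) k = nat \<bar>d X (w, k)\<bar>" for X w k
      by (simp add: d_def gap_def)
    obtain R where R: "\<And>X. X \<in> linked_walks N m \<Longrightarrow>
        R X \<subseteq> P \<and> card (R X) + 2 \<le> 2 * m \<and> determining m X (R X)"
    proof -
      have "\<forall>X\<in>linked_walks N m. \<exists>R. R \<subseteq> P \<and> card R + 2 \<le> 2 * m \<and> determining m X R"
        using linked_walks_determined unfolding P_def by blast
      from bchoice[OF this] show ?thesis using that by blast
    qed
    have det: "gap (X w) k \<in> K"
      if X: "X \<in> linked_walks N m" and onR: "\<And>w k. (w, k) \<in> R X \<Longrightarrow> gap (X w) k \<in> K"
        and close: "\<And>w k. w < 4 \<Longrightarrow> k < m \<Longrightarrow> occ m (X w) (gap (X w) k) = 1 \<Longrightarrow>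
          (\<forall>l<m. gap (X w) l \<noteq> gap (X w) k \<longrightarrow> gap (X w) l \<in> K) \<Longrightarrow> gap (X w) k \<in> K"
        and wk: "w < 4" "k < m" for X K w k
    proof -
      have "determining m X (R X)" using R[OF X] by blast
      note this[unfolded determining_def, THEN spec[of _ K]]
      then show ?thesis using onR close wk by blast
    qed
    \<comment> \<open>A gap fixes a step only up to sign. These two relations record the relative
      signs, so one known step gives all steps with the same gap.\<close>
    define eq_rel where "eq_rel X = {(p, q) \<in> P \<times> P. d X p = d X q}" for X
    define neg_rel where "neg_rel X = {(p, q) \<in> P \<times> P. d X p = - d X q}" for X
    define key where "key X = (\<lambda>w\<in>{..<4::nat}. X w 0, eq_rel X, neg_rel X, R X, restrict (d X) (R X))" for X
    define B where "B = ({..<4::nat} \<rightarrow>\<^sub>E {..<N}) \<times> Pow (P \<times> P) \<times> Pow (P \<times> P) \<times>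
        (SIGMA S:sets. S \<rightarrow>\<^sub>E {- int N..int N})"
    have finS: "finite (S \<rightarrow>\<^sub>E {- int N..int N})" if "S \<in> sets" for S
      using that finite_subset[OF _ finP, of S] by (intro finite_PiE) (auto simp: sets_def)
    have finB: "finite B"
    proof -
      have "finite (SIGMA S:sets. S \<rightarrow>\<^sub>E {- int N..int N})"
        using fins finS by (rule finite_SigmaI)
      moreover have "finite ({..<4::nat} \<rightarrow>\<^sub>E {..<N})" by (intro finite_PiE) auto
      ultimately show ?thesis unfolding B_def using finP by simp
    qed
    have cwX: "X w \<in> closed_walks N m" if "X \<in> linked_walks N m" "w < 4" for X w
      using that by (auto simp: linked_walks_def)
    have "key ` linked_walks N m \<subseteq> B"
    proof (rule image_subsetI)
      fix X assume X: "X \<in> linked_walks N m"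
      have "d X p \<in> {- int N..int N}" if "p \<in> R X" for p
        using R[OF X] that step_in[OF cwX[OF X]] by (force simp: P_def d_def)
      moreover have "X w 0 < N" if "w < 4" for w
        using closed_walks_less[OF cwX[OF X that]] by blast
      ultimately show "key X \<in> B"
        using R[OF X] by (auto simp: key_def B_def sets_def eq_rel_def neg_rel_def)
    qed
    moreover have "inj_on key (linked_walks N m)"
    proof (rule inj_onI)
      fix X Y
      assume X: "X \<in> linked_walks N m" and Y: "Y \<in> linked_walks N m" and eq: "key X = key Y"
      have start: "X w 0 = Y w 0" if "w < 4" for w
      proof -
        have "(\<lambda>w\<in>{..<4::nat}. X w 0) = (\<lambda>w\<in>{..<4::nat}. Y w 0)" using eq by (simp add: key_def)
        from fun_cong[OF this, of w] show ?thesis using that by simp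
      qed
      have rel1: "d X p = d X q \<longleftrightarrow> d Y p = d Y q" if "p \<in> P" "q \<in> P" for p q
      proof -
        have "(p, q) \<in> eq_rel X \<longleftrightarrow> (p, q) \<in> eq_rel Y" using eq by (simp add: key_def)
        then show ?thesis using that by (simp add: eq_rel_def)
      qed
      have rel2: "d X p = - d X q \<longleftrightarrow> d Y p = - d Y q" if "p \<in> P" "q \<in> P" for p q
      proof -
        have "(p, q) \<in> neg_rel X \<longleftrightarrow> (p, q) \<in> neg_rel Y" using eq by (simp add: key_def)
        then show ?thesis using that by (simp add: neg_rel_def)
      qed
      have onR: "d X p = d Y p" if "p \<in> R X" for p
      proof -
        have "restrict (d X) (R X) = restrict (d Y) (R X)" using eq unfolding key_def prod.inject by metis
        from fun_cong[OF this, of p] show ?thesis using that by simp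
      qed
      have transfer_d: "d X q = d Y q" if "p \<in> P" "q \<in> P" "d X p = d Y p" "nat \<bar>d X p\<bar> = nat \<bar>d X q\<bar>" for p q
      proof -
        have "d X q = d X p \<or> d X q = - d X p" using that(4) by linarith
        then show ?thesis using rel1[OF that(2,1)] rel2[OF that(2,1)] that(3) by auto
      qed
      \<comment> \<open>The gaps of \<open>X\<close> at which \<open>X\<close> and \<open>Y\<close>
        agree in every step. The property \<open>determining\<close> is applied to this set; by
        \<open>transfer_d\<close>, agreement at one position with a given gap already puts the gap
        into \<open>K\<close>.\<close>
      define K where "K = {c. \<forall>p\<in>P. nat \<bar>d X p\<bar> = c \<longrightarrow> d X p = d Y p}"
      have KI: "nat \<bar>d X p\<bar> \<in> K" if "p \<in> P" "d X p = d Y p" for p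
        using transfer_d[OF that(1) _ that(2)] by (auto simp: K_def)
      have all: "gap (X w) k \<in> K" if "w < 4" "k < m" for w k
      proof (rule det[OF X _ _ that])
        fix w k assume "(w, k) \<in> R X"
        then show "gap (X w) k \<in> K"
          using onR R[OF X] unfolding abs_d by (intro KI) auto
      next
        fix w k
        assume w: "w < 4" "k < m" and one: "occ m (X w) (gap (X w) k) = 1"
          and oth: "\<forall>l<m. gap (X w) l \<noteq> gap (X w) k \<longrightarrow> gap (X w) l \<in> K"
        have uniq: "gap (X w) l \<noteq> gap (X w) k" if "l < m" "l \<noteq> k" for l
        proof
          assume "gap (X w) l = gap (X w) k"
          then have "card {l, k} \<le> occ m (X w) (gap (X w) k)"
            unfolding occ_def by (intro card_mono) (use that w in auto)
          then show False using one that by simp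
        qed
        have "step (X w) l = step (Y w) l" if "l \<in> {..<m} - {k}" for l
        proof -
          have "gap (X w) l \<in> K" using oth uniq that by auto
          then have "d X (w, l) = d Y (w, l)"
            unfolding abs_d K_def using w that by (auto simp: P_def)
          then show ?thesis by (simp add: d_def)
        qed
        \<comment> \<open>All steps but the one at \<open>k\<close> agree, and the steps of a closed
          walk add up to 0, so the step at \<open>k\<close> agrees as well, including its
          sign.\<close>
        then have "(\<Sum>l\<in>{..<m} - {k}. step (X w) l) = (\<Sum>l\<in>{..<m} - {k}. step (Y w) l)"
          by (rule sum.cong[OF refl])
        moreover have "(\<Sum>l<m. step (Z w) l) = 0" if "Z \<in> linked_walks N m" for Z
          using cwX[OF that w(1)] by (simp add: sum_step closed_walks_def)
        then have "(\<Sum>l<m. step (X w) l) = 0" "(\<Sum>l<m. step (Y w) l) = 0"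
          using X Y by auto
        ultimately have "step (X w) k = step (Y w) k"
          using sum.remove[of "{..<m}" k "step (X w)"] sum.remove[of "{..<m}" k "step (Y w)"] w
          by simp
        then show "gap (X w) k \<in> K"
          unfolding abs_d by (intro KI) (use w in \<open>auto simp: P_def d_def\<close>)
      qed
      have steps: "step (X w) k = step (Y w) k" if "w < 4" "k < m" for w k
        using all[OF that] that unfolding abs_d K_def by (auto simp: P_def d_def)
      show "X = Y"
      proof (rule PiE_ext[of _ "{..<4}" "\<lambda>_. closed_walks N m"])
        fix w :: nat assume "w \<in> {..<4}"
        then show "X w = Y w"
          using cwX[OF X] cwX[OF Y] start steps by (intro closed_walks_eqI[of _ N m]) auto
      qed (use X Y in \<open>auto simp: linked_walks_def\<close>)
    qed
    ultimately have "card (linked_walks N m) \<le> card B"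
      using finB by (intro card_inj_on_le)
    also have "card B = N ^ 4 * (2 ^ card (P \<times> P) * (2 ^ card (P \<times> P) *
        (\<Sum>S\<in>sets. (2 * N + 1) ^ card S)))"
    proof -
      have "card (S \<rightarrow>\<^sub>E {- int N..int N}) = (2 * N + 1) ^ card S" if "S \<in> sets" for S
      proof -
        have "finite S" using that finite_subset[OF _ finP, of S] by (auto simp: sets_def)
        moreover have "nat (int N + 1 + int N) = 2 * N + 1" by simp
        ultimately show ?thesis by (simp add: card_funcsetE)
      qed
      then have "card (SIGMA S:sets. S \<rightarrow>\<^sub>E {- int N..int N}) = (\<Sum>S\<in>sets. (2 * N + 1) ^ card S)"
        using fins finS by (subst card_SigmaI) auto
      moreover have "card ({..<4::nat} \<rightarrow>\<^sub>E {..<N}) = N ^ 4" by (simp add: card_funcsetE)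
      ultimately show ?thesis
        unfolding B_def card_cartesian_product using finP by (simp add: card_Pow card_cartesian_product)
    qed
    also have "\<dots> \<le> N ^ 4 * (2 ^ card (P \<times> P) * (2 ^ card (P \<times> P) *
        (card sets * (3 ^ (2 * m) * N ^ (2 * m - 2)))))"
    proof -
      have "(2 * N + 1) ^ card S \<le> 3 ^ (2 * m) * N ^ (2 * m - 2)" if "S \<in> sets" for S
      proof -
        have S: "card S \<le> 2 * m - 2" using that by (auto simp: sets_def)
        have "(2 * N + 1) ^ card S \<le> (3 * N) ^ card S"
          using N by (intro power_mono) auto
        also have "\<dots> \<le> (3 * N) ^ (2 * m - 2)"
          using N S by (intro power_increasing) auto
        also have "\<dots> = 3 ^ (2 * m - 2) * N ^ (2 * m - 2)"
          by (simp add: power_mult_distrib)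
        also have "\<dots> \<le> 3 ^ (2 * m) * N ^ (2 * m - 2)"
          by (intro mult_right_mono power_increasing) auto
        finally show ?thesis .
      qed
      then have "(\<Sum>S\<in>sets. (2 * N + 1) ^ card S) \<le> card sets * (3 ^ (2 * m) * N ^ (2 * m - 2))"
        using sum_bounded_above[of sets "\<lambda>S. (2 * N + 1) ^ card S"] by auto
      then show ?thesis by (intro mult_left_mono) auto
    qed
    finally have le: "card (linked_walks N m) \<le> C * (N ^ 4 * N ^ (2 * m - 2))"
      by (simp add: C_def mult_ac)
    \<comment> \<open>The case \<open>m = 0\<close> is separate because \<open>2 * m - 2\<close> is
      truncated there and the exponents do not add up to \<open>2 * m + 2\<close>; walks of length 0
      have no gap to share, so nothing is linked.\<close>
    show ?thesis
    proof (cases "m = 0")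
      case True
      then have "linked_walks N m = {}"
        by (auto simp: linked_walks_def occ_def intro: exI[of _ "0::nat"])
      then show ?thesis by simp
    next
      case False
      then have "N ^ 4 * N ^ (2 * m - 2) = N ^ (2 * m + 2)"
        by (simp flip: power_add)
      then have "card (linked_walks N m) \<le> C * N ^ (2 * m + 2)" using le by simp
      then show ?thesis by (metis of_nat_le_iff of_nat_mult of_nat_power)
    qed
  qed
  then show ?thesis by blast
qed

section \<open>Products of centred monomials in independent variables\<close>

text \<open>With \<open>\<mu> k\<close> the k-th moment of each of the independent variables indexed
  by \<open>I\<close>, this is the expectation of the product over \<open>W\<close> of the monomials
  with exponents \<open>n w\<close>, each minus its mean. The product is multiplied out,
  \<open>S\<close> being the set of factors that contribute the monomial. In this form vanishing and
  size are questions of algebra.\<close>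

definition centered_moment ::
  "(nat \<Rightarrow> real) \<Rightarrow> 'c set \<Rightarrow> ('w \<Rightarrow> 'c \<Rightarrow> nat) \<Rightarrow> 'w set \<Rightarrow> real" where
  "centered_moment \<mu> I n W =
     (\<Sum>S\<in>Pow W. (\<Prod>c\<in>I. \<mu> (\<Sum>w\<in>S. n w c)) * (\<Prod>w\<in>W - S. - (\<Prod>c\<in>I. \<mu> (n w c))))"

text \<open>Each summand vanishes on its own: the single occurrence of \<open>c\<close> lies either
  in the joint monomial over \<open>S\<close> or in one of the separate means, and gives a factor
  \<open>\<mu> 1 = 0\<close> there.\<close>

lemma centered_moment_eq_0_if_single:
  assumes "finite I" "finite W" "\<mu> 1 = 0" "c \<in> I" and one: "(\<Sum>w\<in>W. n w c) = 1"
  shows "centered_moment \<mu> I n W = 0"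
  unfolding centered_moment_def
proof (rule sum.neutral, rule ballI)
  fix S assume S: "S \<in> Pow W"
  have "(\<Sum>w\<in>W - S. n w c) + (\<Sum>w\<in>S. n w c) = 1"
    using sum.subset_diff[of S W "\<lambda>w. n w c"] S assms(2) one by simp
  then consider "(\<Sum>w\<in>S. n w c) = 1" | "(\<Sum>w\<in>W - S. n w c) = 1" by linarith
  then show "(\<Prod>c\<in>I. \<mu> (\<Sum>w\<in>S. n w c)) * (\<Prod>w\<in>W - S. - (\<Prod>c\<in>I. \<mu> (n w c))) = 0"
  proof cases
    case 1
    then have "(\<Prod>c\<in>I. \<mu> (\<Sum>w\<in>S. n w c)) = 0"
      using assms by (intro prod_zero bexI[of _ c]) auto
    then show ?thesis by simp
  next
    case 2
    then obtain w where w: "w \<in> W - S" "n w c = 1"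
      using sum_eq_1_iff[of "W - S" "\<lambda>w. n w c"] assms(2) by auto
    then have "(\<Prod>c\<in>I. \<mu> (n w c)) = 0"
      using assms by (intro prod_zero bexI[of _ c]) auto
    then have "(\<Prod>w\<in>W - S. - (\<Prod>c\<in>I. \<mu> (n w c))) = 0"
      using assms w by (intro prod_zero bexI[of _ w]) auto
    then show ?thesis by simp
  qed
qed

text \<open>The summands for \<open>S\<close> and \<open>insert w0 S\<close> cancel: the monomial of
  \<open>w0\<close> has no variable in common with the others, so its mean splits off the joint
  moment and meets the same mean with the opposite sign.\<close>

lemma centered_moment_eq_0_if_isolated:
  assumes fin: "finite I" "finite W" and "\<mu> 0 = 1" and w0: "w0 \<in> W"
    and iso: "\<And>c w. c \<in> I \<Longrightarrow> n w0 c > 0 \<Longrightarrow> w \<in> W \<Longrightarrow> w \<noteq> w0 \<Longrightarrow> n w c = 0"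
  shows "centered_moment \<mu> I n W = 0"
proof -
  define U where "U = W - {w0}"
  have W: "W = insert w0 U" "w0 \<notin> U" "finite U" using w0 fin by (auto simp: U_def)
  let ?p = "\<lambda>S. \<Prod>c\<in>I. \<mu> (\<Sum>w\<in>S. n w c)" and ?e = "\<lambda>w. \<Prod>c\<in>I. \<mu> (n w c)"
  let ?f = "\<lambda>S. ?p S * (\<Prod>w\<in>W - S. - ?e w)"
  have pair: "?f (insert w0 S) = - ?f S" if "S \<in> Pow U" for S
  proof -
    have S: "finite S" "w0 \<notin> S" "S \<subseteq> U" using that W finite_subset by auto
    \<comment> \<open>At each \<open>c\<close> one of the two exponents is 0, and
      \<open>\<mu> 0 = 1\<close>.\<close>
    have "\<mu> (\<Sum>w\<in>insert w0 S. n w c) = \<mu> (n w0 c) * \<mu> (\<Sum>w\<in>S. n w c)" if "c \<in> I" for c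
    proof (cases "n w0 c = 0")
      case False
      then have "(\<Sum>w\<in>S. n w c) = 0"
        using iso[OF that] S W by (intro sum.neutral) auto
      then show ?thesis using S \<open>\<mu> 0 = 1\<close> by simp
    qed (use S \<open>\<mu> 0 = 1\<close> in simp)
    then have "?p (insert w0 S) = ?e w0 * ?p S"
      by (simp add: prod.distrib)
    moreover have "W - insert w0 S = U - S" "W - S = insert w0 (U - S)"
      using W S by auto
    ultimately show ?thesis using W S by simp
  qed
  have "centered_moment \<mu> I n W = (\<Sum>S\<in>Pow U. ?f S) + (\<Sum>S\<in>insert w0 ` Pow U. ?f S)"
    unfolding centered_moment_def using W by (subst W(1), subst Pow_insert, subst sum.union_disjoint) auto
  also have "(\<Sum>S\<in>insert w0 ` Pow U. ?f S) = (\<Sum>S\<in>Pow U. ?f (insert w0 S))"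
    by (subst sum.reindex) (use W in \<open>auto simp: inj_on_def\<close>)
  also have "\<dots> = - (\<Sum>S\<in>Pow U. ?f S)"
    unfolding sum_negf[symmetric] by (rule sum.cong[OF refl pair])
  finally show ?thesis by simp
qed

text \<open>Factors with exponent 0 equal 1, and the number of other factors is at most the sum of
  the exponents. The bound therefore does not depend on the size of \<open>I\<close>, which will
  grow with \<open>N\<close>.\<close>

lemma abs_prod_le_power_sum:
  fixes f :: "'c \<Rightarrow> nat"
  assumes "finite I" "\<mu> 0 = 1" "B \<ge> 1" and "\<And>k. k \<le> K \<Longrightarrow> \<bar>\<mu> k :: real\<bar> \<le> B" and "(\<Sum>c\<in>I. f c) \<le> K"
  shows "\<bar>\<Prod>c\<in>I. \<mu> (f c)\<bar> \<le> B ^ (\<Sum>c\<in>I. f c)"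
proof -
  have "\<bar>\<mu> (f c)\<bar> \<le> B ^ f c" if "c \<in> I" for c
  proof (cases "f c = 0")
    case False
    have "f c \<le> K" using member_le_sum[of c I f] assms that by simp
    then have "\<bar>\<mu> (f c)\<bar> \<le> B ^ 1" using assms by simp
    also have "\<dots> \<le> B ^ f c" using False \<open>B \<ge> 1\<close> by (intro power_increasing) auto
    finally show ?thesis .
  qed (use assms in simp)
  then show ?thesis
    unfolding abs_prod power_sum by (intro prod_mono) auto
qed

text \<open>There are \<open>2 ^ card W\<close> summands. In each of them the exponents inside and
  outside \<open>S\<close> add up to \<open>K\<close>, so each is at most
  \<open>B ^ K\<close>.\<close>

lemma centered_moment_bound:
  assumes fin: "finite I" "finite W" and mu: "\<mu> 0 = 1" and B: "B \<ge> 1"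
    and le: "\<And>k. k \<le> K \<Longrightarrow> \<bar>\<mu> k\<bar> \<le> B" and K: "(\<Sum>w\<in>W. \<Sum>c\<in>I. n w c) = K"
  shows "\<bar>centered_moment \<mu> I n W\<bar> \<le> 2 ^ card W * B ^ K"
proof -
  have "\<bar>(\<Prod>c\<in>I. \<mu> (\<Sum>w\<in>S. n w c)) * (\<Prod>w\<in>W - S. - (\<Prod>c\<in>I. \<mu> (n w c)))\<bar> \<le> B ^ K"
    if S: "S \<subseteq> W" for S
  proof -
    have swap: "(\<Sum>c\<in>I. \<Sum>w\<in>S. n w c) = (\<Sum>w\<in>S. \<Sum>c\<in>I. n w c)" by (rule sum.swap)
    have split: "(\<Sum>c\<in>I. \<Sum>w\<in>S. n w c) + (\<Sum>w\<in>W - S. \<Sum>c\<in>I. n w c) = K"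
      unfolding swap K[symmetric] using sum.subset_diff[OF S fin(2), of "\<lambda>w. sum (n w) I"] by (simp add: add.commute)
    have "\<bar>\<Prod>c\<in>I. \<mu> (\<Sum>w\<in>S. n w c)\<bar> \<le> B ^ (\<Sum>c\<in>I. \<Sum>w\<in>S. n w c)"
      using fin mu B le split by (intro abs_prod_le_power_sum[where K = K]) auto
    moreover have "\<bar>\<Prod>w\<in>W - S. - (\<Prod>c\<in>I. \<mu> (n w c))\<bar> \<le> B ^ (\<Sum>w\<in>W - S. \<Sum>c\<in>I. n w c)"
      unfolding abs_prod power_sum abs_minus_cancel
    proof (rule prod_mono)
      fix w assume w: "w \<in> W - S"
      have "(\<Sum>c\<in>I. n w c) \<le> (\<Sum>w\<in>W - S. \<Sum>c\<in>I. n w c)"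
        using member_le_sum[OF w, of "\<lambda>w. \<Sum>c\<in>I. n w c"] fin by simp
      then have "\<bar>\<Prod>c\<in>I. \<mu> (n w c)\<bar> \<le> B ^ (\<Sum>c\<in>I. n w c)"
        using fin mu B le split by (intro abs_prod_le_power_sum[where K = K]) auto
      then show "0 \<le> (\<Prod>c\<in>I. \<bar>\<mu> (n w c)\<bar>) \<and> (\<Prod>c\<in>I. \<bar>\<mu> (n w c)\<bar>) \<le> (\<Prod>c\<in>I. B ^ n w c)"
        by (auto simp: abs_prod power_sum intro: prod_nonneg)
    qed
    ultimately have "\<bar>(\<Prod>c\<in>I. \<mu> (\<Sum>w\<in>S. n w c)) * (\<Prod>w\<in>W - S. - (\<Prod>c\<in>I. \<mu> (n w c)))\<bar>
        \<le> B ^ (\<Sum>c\<in>I. \<Sum>w\<in>S. n w c) * B ^ (\<Sum>w\<in>W - S. \<Sum>c\<in>I. n w c)"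
      unfolding abs_mult using B by (intro mult_mono) auto
    then show ?thesis unfolding power_add[symmetric] split .
  qed
  then have "\<bar>centered_moment \<mu> I n W\<bar> \<le> of_nat (card (Pow W)) * B ^ K"
    unfolding centered_moment_def
    by (intro order_trans[OF sum_abs] sum_bounded_above) auto
  then show ?thesis using fin by (simp add: card_Pow)
qed

section \<open>Expectations of products of centred monomials\<close>

context prob_space
begin

lemma indep_vars_monomial:
  fixes X :: "'c \<Rightarrow> 'a \<Rightarrow> real"
  assumes fin: "finite I" and indep: "indep_vars (\<lambda>_. borel) X I"
    and int: "\<And>c k. c \<in> I \<Longrightarrow> integrable M (\<lambda>\<omega>. X c \<omega> ^ k)"
  shows "integrable M (\<lambda>\<omega>. \<Prod>c\<in>I. X c \<omega> ^ n c)"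
    and "expectation (\<lambda>\<omega>. \<Prod>c\<in>I. X c \<omega> ^ n c) = (\<Prod>c\<in>I. expectation (\<lambda>\<omega>. X c \<omega> ^ n c))"
proof -
  have "indep_vars (\<lambda>_. borel) (\<lambda>c \<omega>. X c \<omega> ^ n c) I"
    by (rule indep_vars_compose2[OF indep]) auto
  then show "integrable M (\<lambda>\<omega>. \<Prod>c\<in>I. X c \<omega> ^ n c)"
    and "expectation (\<lambda>\<omega>. \<Prod>c\<in>I. X c \<omega> ^ n c) = (\<Prod>c\<in>I. expectation (\<lambda>\<omega>. X c \<omega> ^ n c))"
    using fin int by (auto intro: indep_vars_integrable indep_vars_lebesgue_integral)
qed

text \<open>After multiplying out over subsets, the powers of each variable are merged and
  independence factors every joint moment. Stating it with \<open>has_bochner_integral\<close>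
  provides integrability together with the value.\<close>

lemma expectation_prod_centered:
  fixes X :: "'c \<Rightarrow> 'a \<Rightarrow> real"
  assumes fin: "finite I" "finite W" and indep: "indep_vars (\<lambda>_. borel) X I"
    and int: "\<And>c k. c \<in> I \<Longrightarrow> integrable M (\<lambda>\<omega>. X c \<omega> ^ k)"
    and mu: "\<And>c k. c \<in> I \<Longrightarrow> expectation (\<lambda>\<omega>. X c \<omega> ^ k) = \<mu> k"
  shows "has_bochner_integral M (\<lambda>\<omega>. \<Prod>w\<in>W. (\<Prod>c\<in>I. X c \<omega> ^ n w c) - (\<Prod>c\<in>I. \<mu> (n w c)))
    (centered_moment \<mu> I n W)"
proof -
  have "(\<lambda>\<omega>. \<Prod>w\<in>W. (\<Prod>c\<in>I. X c \<omega> ^ n w c) - (\<Prod>c\<in>I. \<mu> (n w c))) =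
    (\<lambda>\<omega>. \<Sum>S\<in>Pow W. (\<Prod>c\<in>I. X c \<omega> ^ (\<Sum>w\<in>S. n w c)) * (\<Prod>w\<in>W - S. - (\<Prod>c\<in>I. \<mu> (n w c))))"
    unfolding diff_conv_add_uminus prod_add[OF fin(2)] power_sum
    by (subst prod.swap) (rule refl)
  moreover have "has_bochner_integral M (\<lambda>\<omega>. \<Prod>c\<in>I. X c \<omega> ^ (\<Sum>w\<in>S. n w c))
      (\<Prod>c\<in>I. \<mu> (\<Sum>w\<in>S. n w c))" for S
    using indep_vars_monomial[OF fin(1) indep int, of "\<lambda>c. \<Sum>w\<in>S. n w c"] mu
    by (simp add: has_bochner_integral_iff)
  ultimately show ?thesis
    unfolding centered_moment_def
    by (auto intro!: has_bochner_integral_sum has_bochner_integral_mult_left)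
qed

end

section \<open>The trace as a sum over closed walks\<close>

text \<open>Induction on the length: a walk of length \<open>Suc m\<close> from \<open>i\<close> to
  \<open>j\<close> is a walk of length \<open>m\<close> from \<open>i\<close> to some
  \<open>l\<close>, followed by the step from \<open>l\<close> to \<open>j\<close>.\<close>

lemma pow_mat_index:
  fixes A :: "real mat"
  assumes A: "A \<in> carrier_mat N N" and "i < N" "j < N"
  shows "(A ^\<^sub>m m) $$ (i, j) =
    (\<Sum>x\<in>{x \<in> {..m} \<rightarrow>\<^sub>E {..<N}. x 0 = i \<and> x m = j}. \<Prod>k<m. A $$ (x k, x (Suc k)))"
  using \<open>j < N\<close>
proof (induction m arbitrary: j)
  case 0
  have "{x \<in> {..0::nat} \<rightarrow>\<^sub>E {..<N}. x 0 = i \<and> x 0 = j} = (if i = j then {\<lambda>k\<in>{..0}. i} else {})"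
    using \<open>i < N\<close> by (auto simp: PiE_def extensional_def fun_eq_iff)
  then show ?case using A \<open>i < N\<close> \<open>j < N\<close> 0 by auto
next
  case (Suc m)
  let ?W = "\<lambda>m j. {x \<in> {..m} \<rightarrow>\<^sub>E {..<N}. x 0 = i \<and> x m = j}"
  let ?P = "\<lambda>m x. \<Prod>k<m. A $$ (x k, x (Suc k))"
  have fin: "finite (?W m l)" for l
    by (rule finite_subset[of _ "{..m} \<rightarrow>\<^sub>E {..<N}"]) (auto intro: finite_PiE)
  have dims: "A ^\<^sub>m m \<in> carrier_mat N N" using A by simp
  have "(A ^\<^sub>m Suc m) $$ (i, j) = (\<Sum>l<N. (A ^\<^sub>m m) $$ (i, l) * A $$ (l, j))"
    using A dims Suc.prems \<open>i < N\<close>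
    by (simp add: scalar_prod_def atLeast0LessThan)
  also have "\<dots> = (\<Sum>l<N. \<Sum>x\<in>?W m l. ?P m x * A $$ (x m, j))"
    using Suc.IH by (auto simp: sum_distrib_right intro!: sum.cong)
  also have "\<dots> = (\<Sum>x\<in>(\<Union>l\<in>{..<N}. ?W m l). ?P m x * A $$ (x m, j))"
    by (rule sum.UNION_disjoint[symmetric]) (use fin in auto)
  also have "\<dots> = (\<Sum>x\<in>?W (Suc m) j. ?P (Suc m) x)"
  proof (rule sum.reindex_bij_witness[where i = "\<lambda>x. restrict x {..m}" and j = "\<lambda>x. x(Suc m := j)"])
    fix x assume x: "x \<in> (\<Union>l\<in>{..<N}. ?W m l)"
    show "restrict (x(Suc m := j)) {..m} = x"
      using x by (auto simp: PiE_def extensional_def fun_eq_iff)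
    show "x(Suc m := j) \<in> ?W (Suc m) j"
      using x Suc.prems by (auto simp: PiE_def extensional_def Pi_def)
    have "?P m (x(Suc m := j)) = ?P m x" by (rule prod.cong) auto
    then show "?P (Suc m) (x(Suc m := j)) = ?P m x * A $$ (x m, j)" by simp
  next
    fix x assume x: "x \<in> ?W (Suc m) j"
    show "(restrict x {..m})(Suc m := j) = x"
      using x by (auto simp: PiE_def extensional_def fun_eq_iff)
    show "restrict x {..m} \<in> (\<Union>l\<in>{..<N}. ?W m l)"
      using x by (auto simp: PiE_def Pi_def)
  qed
  finally show ?case .
qed

lemma prod_gap_eq_prod_occ:
  fixes b :: "nat \<Rightarrow> real"
  assumes "x \<in> closed_walks N m"
  shows "(\<Prod>k<m. b (gap x k)) = (\<Prod>c\<in>{1..<N}. b c ^ occ m x c)"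
proof -
  have "(\<Prod>k<m. b (gap x k)) = (\<Prod>c\<in>{1..<N}. \<Prod>k\<in>{k \<in> {..<m}. gap x k = c}. b (gap x k))"
    by (rule prod.group[symmetric]) (use gap_in[OF assms] in auto)
  also have "\<dots> = (\<Prod>c\<in>{1..<N}. b c ^ occ m x c)"
    by (rule prod.cong) (auto simp: occ_def)
  finally show ?thesis .
qed

lemma trace_toeplitz_power:
  "mat_trace (toeplitz_mat N b ^\<^sub>m m) = (\<Sum>x\<in>closed_walks N m. \<Prod>c\<in>{1..<N}. b c ^ occ m x c)"
proof -
  define A where "A = toeplitz_mat N b"
  have A: "A \<in> carrier_mat N N" by (simp add: A_def toeplitz_mat_def)
  let ?P = "\<lambda>x. \<Prod>k<m. A $$ (x k, x (Suc k))"
  let ?W = "{x \<in> {..m} \<rightarrow>\<^sub>E {..<N}. x m = x 0}"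
  have finW: "finite ?W"
    by (rule finite_subset[of _ "{..m} \<rightarrow>\<^sub>E {..<N}"]) (auto intro: finite_PiE)
  have "mat_trace (A ^\<^sub>m m) = (\<Sum>i<N. \<Sum>x\<in>{x \<in> ?W. x 0 = i}. ?P x)"
  proof -
    have "mat_trace (A ^\<^sub>m m) = (\<Sum>i<N. (A ^\<^sub>m m) $$ (i, i))"
      unfolding mat_trace_def using A by simp
    also have "\<dots> = (\<Sum>i<N. \<Sum>x\<in>{x \<in> ?W. x 0 = i}. ?P x)"
    proof (rule sum.cong[OF refl])
      fix i assume "i \<in> {..<N}"
      moreover have "{x \<in> {..m} \<rightarrow>\<^sub>E {..<N}. x 0 = i \<and> x m = i} = {x \<in> ?W. x 0 = i}" by auto
      ultimately show "(A ^\<^sub>m m) $$ (i, i) = (\<Sum>x\<in>{x \<in> ?W. x 0 = i}. ?P x)"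
        using pow_mat_index[OF A, of i i m] by simp
    qed
    finally show ?thesis .
  qed
  also have "\<dots> = (\<Sum>x\<in>?W. ?P x)"
    by (rule sum.group) (use finW in auto)
  \<comment> \<open>A closed walk with a stationary step contributes 0, since the product then
    contains a diagonal entry.\<close>
  also have "\<dots> = (\<Sum>x\<in>closed_walks N m. ?P x)"
  proof (rule sum.mono_neutral_right[OF finW])
    show "closed_walks N m \<subseteq> ?W" by (auto simp: closed_walks_def)
    show "\<forall>x\<in>?W - closed_walks N m. ?P x = 0"
    proof
      fix x assume x: "x \<in> ?W - closed_walks N m"
      then obtain k where k: "k < m" "x k = x (Suc k)" by (auto simp: closed_walks_def)
      then have "x k < N" using x by (auto simp: PiE_def Pi_def)
      then have "A $$ (x k, x (Suc k)) = 0" using k by (auto simp: A_def toeplitz_mat_def)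
      then show "?P x = 0" using k by (intro prod_zero bexI[of _ k]) auto
    qed
  qed
  also have "\<dots> = (\<Sum>x\<in>closed_walks N m. \<Prod>c\<in>{1..<N}. b c ^ occ m x c)"
  proof (rule sum.cong[OF refl])
    fix x assume x: "x \<in> closed_walks N m"
    have "?P x = (\<Prod>k<m. b (gap x k))"
    proof (rule prod.cong[OF refl])
      fix k assume "k \<in> {..<m}"
      moreover from this have "x k < N" "x (Suc k) < N"
        using closed_walks_less[OF x] by auto
      ultimately show "A $$ (x k, x (Suc k)) = b (gap x k)"
        using x by (auto simp: A_def toeplitz_mat_def gap_def step_def closed_walks_def)
    qed
    then show "?P x = (\<Prod>c\<in>{1..<N}. b c ^ occ m x c)"
      using prod_gap_eq_prod_occ[OF x] by simp
  qed
  finally show ?thesis by (simp add: A_def)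
qed

section \<open>From the count of linked quadruples to the fourth central moment\<close>

lemma (in prob_space) fourth_central_moment_trace:
  fixes X :: "nat \<Rightarrow> 'a \<Rightarrow> real"
  assumes indep: "indep_vars (\<lambda>_. borel) X {1..<N}"
    and int: "\<And>c k. c \<in> {1..<N} \<Longrightarrow> integrable M (\<lambda>\<omega>. X c \<omega> ^ k)"
    and mu: "\<And>c k. c \<in> {1..<N} \<Longrightarrow> expectation (\<lambda>\<omega>. X c \<omega> ^ k) = \<mu> k"
    and mu0: "\<mu> 0 = 1" and mu1: "\<mu> 1 = 0"
    and B: "B \<ge> 1" "\<And>k. k \<le> 4 * m \<Longrightarrow> \<bar>\<mu> k\<bar> \<le> B"
  defines "F \<equiv> \<lambda>\<omega>. \<Sum>x\<in>closed_walks N m. \<Prod>c\<in>{1..<N}. X c \<omega> ^ occ m x c"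
  shows "expectation (\<lambda>\<omega>. (F \<omega> - expectation F) ^ 4) \<le> real (card (linked_walks N m)) * (16 * B ^ (4 * m))"
proof -
  let ?I = "{1..<N}" and ?W = "closed_walks N m"
  let ?Q = "{..<4::nat} \<rightarrow>\<^sub>E ?W"
  let ?cm = "\<lambda>Y. centered_moment \<mu> ?I (\<lambda>w. occ m (Y w)) {..<4}"
  have eF: "expectation F = (\<Sum>x\<in>?W. \<Prod>c\<in>?I. \<mu> (occ m x c))"
    unfolding F_def
    using indep_vars_monomial[OF _ indep int] mu by (subst Bochner_Integration.integral_sum) auto
  have F4: "(F \<omega> - expectation F) ^ 4 =
      (\<Sum>Y\<in>?Q. \<Prod>w<4. (\<Prod>c\<in>?I. X c \<omega> ^ occ m (Y w) c) - (\<Prod>c\<in>?I. \<mu> (occ m (Y w) c)))" for \<omega>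
  proof -
    \<comment> \<open>The fourth power is written as a product over \<open>w < 4\<close> of sums
      over walks, so that multiplying it out yields a sum over quadruples of closed walks.\<close>
    have "(F \<omega> - expectation F) ^ 4 =
      (\<Prod>w<4::nat. \<Sum>x\<in>?W. (\<Prod>c\<in>?I. X c \<omega> ^ occ m x c) - (\<Prod>c\<in>?I. \<mu> (occ m x c)))"
      unfolding eF by (simp add: F_def sum_subtractf)
    also have "\<dots> = (\<Sum>Y\<in>?Q. \<Prod>w<4. (\<Prod>c\<in>?I. X c \<omega> ^ occ m (Y w) c) - (\<Prod>c\<in>?I. \<mu> (occ m (Y w) c)))"
      by (rule prod_sum_PiE) (auto simp: finite_closed_walks)
    finally show ?thesis .
  qed
  have "has_bochner_integral M (\<lambda>\<omega>. (F \<omega> - expectation F) ^ 4) (\<Sum>Y\<in>?Q. ?cm Y)"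
    unfolding F4
    by (intro has_bochner_integral_sum expectation_prod_centered) (use indep int mu in auto)
  then have "expectation (\<lambda>\<omega>. (F \<omega> - expectation F) ^ 4) = (\<Sum>Y\<in>?Q. ?cm Y)"
    by (rule has_bochner_integral_integral_eq)
  also have "\<dots> = (\<Sum>Y\<in>linked_walks N m. ?cm Y)"
  proof (rule sum.mono_neutral_right)
    show "finite ?Q" by (intro finite_PiE) (auto simp: finite_closed_walks)
    show "linked_walks N m \<subseteq> ?Q" by (auto simp: linked_walks_def)
    show "\<forall>Y\<in>?Q - linked_walks N m. ?cm Y = 0"
    proof
      fix Y assume Y: "Y \<in> ?Q - linked_walks N m"
      then consider c where "c \<in> ?I" "(\<Sum>w<4. occ m (Y w) c) = 1"
        | w where "w < 4" "\<not> (\<exists>c\<in>?I. \<exists>w'<4. w' \<noteq> w \<and> occ m (Y w) c > 0 \<and> occ m (Y w') c > 0)"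
        unfolding linked_walks_def by blast
      then show "?cm Y = 0"
      proof cases
        case 1
        then show ?thesis using mu1 by (intro centered_moment_eq_0_if_single) auto
      next
        case 2
        have "occ m (Y w') c = 0" if "c \<in> ?I" "occ m (Y w) c > 0" "w' < 4" "w' \<noteq> w" for c w'
        proof (rule ccontr)
          assume "occ m (Y w') c \<noteq> 0"
          then have "\<exists>w'<4. w' \<noteq> w \<and> occ m (Y w) c > 0 \<and> occ m (Y w') c > 0"
            using that by (intro exI[of _ w']) simp
          then show False using 2(2) \<open>c \<in> ?I\<close> by (elim notE) (rule bexI)
        qed
        then show ?thesis
          using mu0 \<open>w < 4\<close> by (intro centered_moment_eq_0_if_isolated[of _ _ _ w]) auto
      qed
    qed
  qed
  \<comment> \<open>The constant 16 is the number of subsets of the four walks, and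
    \<open>4 * m\<close> is the sum of all exponents, since each walk has \<open>m\<close>
    steps.\<close>
  also have "\<dots> \<le> real (card (linked_walks N m)) * (16 * B ^ (4 * m))"
  proof (rule sum_bounded_above)
    fix Y assume "Y \<in> linked_walks N m"
    then have "Y w \<in> ?W" if "w < 4" for w using that by (auto simp: linked_walks_def)
    then have "(\<Sum>c\<in>?I. occ m (Y w) c) = m" if "w < 4" for w
      using gap_in that by (intro sum_occ) blast+
    then have "(\<Sum>w<4. \<Sum>c\<in>?I. occ m (Y w) c) = 4 * m" by simp
    then have "\<bar>?cm Y\<bar> \<le> 2 ^ card {..<4::nat} * B ^ (4 * m)"
      using mu0 B by (intro centered_moment_bound) auto
    then show "?cm Y \<le> 16 * B ^ (4 * m)" by simp
  qed
  finally show ?thesis .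
qed

theorem theorem6:
  fixes p :: "real \<Rightarrow> real"
  assumes p_meas: "p \<in> borel_measurable borel"
    and p_nonneg: "\<And>x. p x \<ge> 0"
    and p_int: "integrable lborel p"
    and p_total: "(\<integral>x. p x \<partial>lborel) = 1"
    and p_moments: "\<And>k::nat. integrable lborel (\<lambda>x. \<bar>x\<bar> ^ k * p x)"
    and p_mean: "(\<integral>x. x * p x \<partial>lborel) = 0"
    and p_var: "(\<integral>x. x\<^sup>2 * p x \<partial>lborel) = 1"
    and p_even: "\<And>x. p (- x) = p x"
  shows "\<forall>m::nat. \<exists>C::real. \<forall>N::nat. N \<ge> 1 \<longrightarrow>
           (\<forall>(M :: 'a measure) (X :: nat \<Rightarrow> 'a \<Rightarrow> real).
              prob_space M \<and> prob_space.indep_vars M (\<lambda>_. borel) X {1..<N} \<and>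
              (\<forall>i\<in>{1..<N}. distributed M lborel (X i) (\<lambda>x. ennreal (p x)))
              \<longrightarrow>
              (let S = (\<lambda>\<omega>. moment_stat N m (\<lambda>k. if k = 0 then 0 else X k \<omega>))
               in (\<integral>\<omega>. \<bar>S \<omega> - (\<integral>\<omega>'. S \<omega>' \<partial>M)\<bar> ^ 4 \<partial>M) \<le> C / (real N)\<^sup>2))"
proof
  fix m :: nat
  define \<mu> where "\<mu> k = (\<integral>x. p x * x ^ k \<partial>lborel)" for k
  have p_pow: "integrable lborel (\<lambda>x. p x * x ^ k)" for k
    by (rule Bochner_Integration.integrable_bound[OF p_moments[of k]])
       (use p_meas p_nonneg in \<open>auto simp: abs_mult power_abs\<close>)
  have mu0: "\<mu> 0 = 1" and mu1: "\<mu> 1 = 0"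
    using p_total p_mean by (simp_all add: \<mu>_def mult.commute)
  \<comment> \<open>A common bound, at least 1, for all moments up to order \<open>4 * m\<close>,
    the largest exponent that a quadruple can produce.\<close>
  define B where "B = 1 + (\<Sum>k\<le>4 * m. \<bar>\<mu> k\<bar>)"
  have B: "B \<ge> 1" unfolding B_def by (simp add: sum_nonneg)
  have muB: "\<bar>\<mu> k\<bar> \<le> B" if "k \<le> 4 * m" for k
    unfolding B_def using member_le_sum[of k "{..4 * m}" "\<lambda>k. \<bar>\<mu> k\<bar>"] that by auto
  obtain C where C: "\<And>N. N \<ge> 1 \<Longrightarrow> real (card (linked_walks N m)) \<le> C * real N ^ (2 * m + 2)"
    using card_linked_walks[of m] by blast
  have "(let S = (\<lambda>\<omega>. moment_stat N m (\<lambda>k. if k = 0 then 0 else X k \<omega>))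
     in (\<integral>\<omega>. \<bar>S \<omega> - (\<integral>\<omega>'. S \<omega>' \<partial>M)\<bar> ^ 4 \<partial>M) \<le> C * (16 * B ^ (4 * m)) / (real N)\<^sup>2)"
    if N: "N \<ge> 1" and M: "prob_space M" and indep: "prob_space.indep_vars M (\<lambda>_. borel) X {1..<N}"
      and dist: "\<forall>i\<in>{1..<N}. distributed M lborel (X i) (\<lambda>x. ennreal (p x))"
    for N and M :: "'a measure" and X :: "nat \<Rightarrow> 'a \<Rightarrow> real"
  proof -
    interpret prob_space M by fact
    define F where "F = (\<lambda>\<omega>. \<Sum>x\<in>closed_walks N m. \<Prod>c\<in>{1..<N}. X c \<omega> ^ occ m x c)"
    define Z where "Z = real N powr (real m / 2 + 1)"
    define S where "S = (\<lambda>\<omega>. moment_stat N m (\<lambda>k. if k = 0 then 0 else X k \<omega>))"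
    have S: "S = (\<lambda>\<omega>. F \<omega> / Z)"
      unfolding S_def moment_stat_def trace_toeplitz_power F_def Z_def
      by (auto intro!: sum.cong prod.cong arg_cong2[where f = "(/)"])
    \<comment> \<open>The exponent is \<open>4 * (m / 2 + 1)\<close>. It exceeds the exponent
      \<open>2 * m + 2\<close> of the count by 2, which is the decay claimed.\<close>
    have Z4: "Z ^ 4 = real N ^ (2 * m + 4)"
    proof -
      have "Z ^ 4 = real N powr (real (2 * m + 4))"
        unfolding Z_def using N by (simp add: powr_power algebra_simps)
      then show ?thesis using N by (subst (asm) powr_realpow) auto
    qed
    have int: "integrable M (\<lambda>\<omega>. X c \<omega> ^ k)" and mu: "expectation (\<lambda>\<omega>. X c \<omega> ^ k) = \<mu> k"
      if "c \<in> {1..<N}" for c k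
      using distributed_integrable[of M lborel "X c" p "\<lambda>x. x ^ k"]
        distributed_integral[of M lborel "X c" p "\<lambda>x. x ^ k"] dist that p_nonneg p_pow
      by (auto simp: \<mu>_def)
    have "\<bar>S \<omega> - expectation S\<bar> ^ 4 = (F \<omega> - expectation F) ^ 4 / Z ^ 4" for \<omega>
      unfolding S by (simp add: power_even_abs power_divide flip: diff_divide_distrib)
    then have "(\<integral>\<omega>. \<bar>S \<omega> - expectation S\<bar> ^ 4 \<partial>M) = expectation (\<lambda>\<omega>. (F \<omega> - expectation F) ^ 4) / Z ^ 4"
      by simp
    also have "\<dots> \<le> real (card (linked_walks N m)) * (16 * B ^ (4 * m)) / Z ^ 4"
      using fourth_central_moment_trace[OF indep int mu mu0 mu1 B muB]
      unfolding F_def by (intro divide_right_mono) (auto simp: Z4)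
    also have "\<dots> \<le> C * real N ^ (2 * m + 2) * (16 * B ^ (4 * m)) / Z ^ 4"
      using C[OF N] B by (intro divide_right_mono mult_right_mono) (auto simp: Z4)
    also have "\<dots> = C * (16 * B ^ (4 * m)) / (real N)\<^sup>2"
    proof -
      have "2 * m + 4 = (2 * m + 2) + 2" by simp
      then have "real N ^ (2 * m + 4) = real N ^ (2 * m + 2) * (real N)\<^sup>2"
        by (simp only: power_add)
      then show ?thesis unfolding Z4 using N by simp
    qed
    finally show ?thesis unfolding S_def Let_def .
  qed
  then show "\<exists>C::real. \<forall>N::nat. N \<ge> 1 \<longrightarrow>
           (\<forall>(M :: 'a measure) (X :: nat \<Rightarrow> 'a \<Rightarrow> real).
              prob_space M \<and> prob_space.indep_vars M (\<lambda>_. borel) X {1..<N} \<and>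
              (\<forall>i\<in>{1..<N}. distributed M lborel (X i) (\<lambda>x. ennreal (p x)))
              \<longrightarrow>
              (let S = (\<lambda>\<omega>. moment_stat N m (\<lambda>k. if k = 0 then 0 else X k \<omega>))
               in (\<integral>\<omega>. \<bar>S \<omega> - (\<integral>\<omega>'. S \<omega>' \<partial>M)\<bar> ^ 4 \<partial>M) \<le> C / (real N)\<^sup>2))"
    by blast
qed

end
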